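(* Let $f:[0,1]\times[0,1]\to\mathbb{R}$ be a non-negative continuous function, and let $0<\gamma_1<1$, $0<\gamma_2<1$, $\gamma=(\gamma_1,\gamma_2)$. If $$\dim_B \mathrm{Gr}(f)=2,$$ then the box dimension of the graph of the mixed Riemann-Liouville fractional integral $\mathcal{I}^{\gamma}f$ on $[0,1]\times[0,1]$ exists and $$\dim_B \mathrm{Gr}(\mathcal{I}^{\gamma}f)=2.$$
   Context: The mixed Riemann-Liouville fractional integral of $f$ on $[0,1]\times[0,1]$ is $$\mathcal{I}^{\gamma}f(x,y)=\frac{1}{\Gamma(\gamma_1)\Gamma(\gamma_2)}\int_0^x\int_0^y (x-u)^{\gamma_1-1}(y-v)^{\gamma_2-1}f(u,v)\,du\,dv .$$ $\mathrm{Gr}(g)=\{(x,y,g(x,y)):(x,y)\in[0,1]\times[0,1]\}\subset\mathbb{R}^3$ is the graph of $g$. For a nonempty bounded set $E\subset\mathbb{R}^n$, $N_\delta(E)$ is the smallest number of sets of diameter at most $\delta$ that cover $E$, and $\dim_B(E)=\lim_{\delta\to0}\frac{\log N_\delta(E)}{-\log\delta}$ is the box dimension; an assertion $\dim_B(E)=s$ includes that the limit exists. *)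

theory Defs
  imports "HOL-Analysis.Analysis"
begin

definition unit_square :: "(real \<times> real) set" where
  "unit_square = {0..1} \<times> {0..1}"

text \<open>
  Here \<open>u\<close> ranges over \<open>[0,x]\<close> and \<open>v\<close> over \<open>[0,y]\<close>. The convention \<open>0 powr a = 0\<close> affects the
  singular kernels only at \<open>u = x\<close> and \<open>v = y\<close>, that is, on null sets.
\<close>

definition mixed_RL_integral ::
    "real \<times> real \<Rightarrow> (real \<times> real \<Rightarrow> real) \<Rightarrow> real \<times> real \<Rightarrow> real" where
  "mixed_RL_integral = (\<lambda>(\<gamma>\<^sub>1, \<gamma>\<^sub>2) f (x, y).
     1 / (Gamma \<gamma>\<^sub>1 * Gamma \<gamma>\<^sub>2) *
     (LINT u:{0..x}|lborel. LINT v:{0..y}|lborel.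
        (x - u) powr (\<gamma>\<^sub>1 - 1) * (y - v) powr (\<gamma>\<^sub>2 - 1) * f (u, v)))"

text \<open>
  The norm on the product type \<open>real \<times> real \<times> real\<close> is the Euclidean norm of three-dimensional space.
\<close>

definition Gr :: "(real \<times> real \<Rightarrow> real) \<Rightarrow> (real \<times> real \<times> real) set" where
  "Gr g = {(x, y, g (x, y)) | x y. (x, y) \<in> unit_square}"

text \<open>
  Covering sets are required to be bounded because the value of \<^const>\<open>diameter\<close> carries no
  information about unbounded sets.
\<close>

definition covering_number :: "real \<Rightarrow> 'a::metric_space set \<Rightarrow> nat" where
  "covering_number \<delta> E =
     (LEAST n. \<exists>\<U>. finite \<U> \<and> card \<U> = n \<and> E \<subseteq> \<Union>\<U> \<and> (\<forall>U\<in>\<U>. bounded U \<and> diameter U \<le> \<delta>))"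

definition has_box_dim :: "'a::euclidean_space set \<Rightarrow> real \<Rightarrow> bool" where
  "has_box_dim E s \<longleftrightarrow> E \<noteq> {} \<and> bounded E \<and>
     ((\<lambda>\<delta>. ln (real (covering_number \<delta> E)) / (- ln \<delta>)) \<longlongrightarrow> s) (at_right 0)"

end

theory Submission
  imports Defs "HOL-Real_Asymp.Real_Asymp"
begin

text \<open>
  The box dimension of a graph over the unit square is governed by the total variation
  of the function over the cells of a grid of side \<open>1/n\<close>. A column over a cell needs about
  \<open>n\<close> times the oscillation of the function there, but at least one, cubes of side \<open>1/n\<close>.
  Conversely, for a continuous function every cover by sets of diameter \<open>1/n\<close> needs that many sets,
  up to a constant (\<open>variation_le_card_over\<close>, \<open>card_cells_over_le\<close>). The graph of any function
  needs at least about \<open>n\<^sup>2\<close> sets (\<open>fine_cover_graph_card_ge\<close>), so 2 is the least possible dimension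
  and only an upper bound for the fractional integral is in question.

  The fractional integral is the convolution of the zero extension of \<open>f\<close> with an integrable kernel
  supported in \<open>[0,1] \<times> [0,1]\<close> (\<open>mixed_RL_integral_eq_convolution\<close>), hence a weighted superposition
  of translates of that extension. Translation hardly affects the variation along a grid: the intermediate value
  argument works for translated cells just as well, and the jump of the extension at the edges of the
  square is felt by \<open>O(n)\<close> cells only, which after multiplication with \<open>n\<close> is of the harmless order
  \<open>n\<^sup>2\<close> (\<open>sum_translated_variation_le\<close>). Integrating against the kernel gives
  \<open>N (2/n) \<le> C * N' (1/n)\<close> for the covering numbers \<open>N\<close> of the graph of the integral
  and \<open>N'\<close> of the graph of \<open>f\<close> (\<open>convolution_covering_number_le\<close>). Since
  \<open>N'\<close> grows with exponent 2, so does \<open>N\<close> (\<open>has_box_dim_Gr_transfer\<close>).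
\<close>

section \<open>Minimal covers\<close>

definition fine_cover :: "real \<Rightarrow> 'a::metric_space set \<Rightarrow> 'a set set \<Rightarrow> bool" where
  "fine_cover \<delta> E \<U> \<longleftrightarrow> finite \<U> \<and> E \<subseteq> \<Union>\<U> \<and> (\<forall>U\<in>\<U>. bounded U \<and> diameter U \<le> \<delta>)"

lemma covering_number_le_card:
  assumes "fine_cover \<delta> E \<U>"
  shows "covering_number \<delta> E \<le> card \<U>"
  unfolding covering_number_def
  by (rule Least_le) (use assms in \<open>auto simp: fine_cover_def\<close>)

lemma minimal_fine_cover:
  assumes "fine_cover \<delta> E \<U>"
  obtains \<V> where "fine_cover \<delta> E \<V>" "card \<V> = covering_number \<delta> E"
proof -
  let ?P = "\<lambda>n. \<exists>\<U>. finite \<U> \<and> card \<U> = n \<and> E \<subseteq> \<Union>\<U> \<and> (\<forall>U\<in>\<U>. bounded U \<and> diameter U \<le> \<delta>)"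
  have "?P (card \<U>)"
    using assms by (auto simp: fine_cover_def)
  then have "?P (LEAST n. ?P n)"
    by (rule LeastI)
  then show ?thesis
    using that unfolding covering_number_def fine_cover_def by blast
qed

lemma fine_cover_exists:
  fixes E :: "'a::euclidean_space set" and \<delta> :: real
  assumes "bounded E" "\<delta> > 0"
  obtains \<U> where "fine_cover \<delta> E \<U>"
proof -
  have "compact (closure E)"
    using assms(1) by simp
  then obtain k where k: "finite k" "closure E \<subseteq> (\<Union>x\<in>k. ball x (\<delta>/2))"
    using compact_eq_totally_bounded[of "closure E"] assms(2)
    by (meson half_gt_zero)
  have "fine_cover \<delta> E ((\<lambda>x. ball x (\<delta>/2)) ` k)"
    using k closure_subset[of E] assms(2) by (auto simp: fine_cover_def)
  then show ?thesis
    by (rule that)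
qed

lemma covering_number_antimono:
  fixes E :: "'a::euclidean_space set" and \<delta> :: real
  assumes "bounded E" "0 < \<delta>" "\<delta> \<le> \<epsilon>"
  shows "covering_number \<epsilon> E \<le> covering_number \<delta> E"
proof -
  obtain \<U> where "fine_cover \<delta> E \<U>"
    using fine_cover_exists assms by metis
  then obtain \<V> where \<V>: "fine_cover \<delta> E \<V>" "card \<V> = covering_number \<delta> E"
    by (rule minimal_fine_cover)
  have "fine_cover \<epsilon> E \<V>"
    using \<V>(1) assms(3) by (force simp: fine_cover_def)
  then show ?thesis
    using covering_number_le_card \<V>(2) by metis
qed

section \<open>Covers of graphs\<close>

text \<open>
  A graph has a point over every node of a grid in the unit square. When the mesh of the
  grid exceeds \<open>\<delta>\<close>, no two of these points fit into one set of diameter \<open>\<delta>\<close>. The hypothesis on \<open>k\<close>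
  says that a grid of \<open>k\<close> nodes per side can have such a mesh. For \<open>\<delta> > 0\<close> it holds when \<open>k\<close> is
  \<open>1/\<delta>\<close> rounded up, and so a cover has at least \<open>1/\<delta>\<^sup>2\<close> members.
\<close>
lemma fine_cover_graph_card_ge:
  fixes h :: "real \<times> real \<Rightarrow> real" and \<delta> :: real
  assumes \<U>: "fine_cover \<delta> (Gr h) \<U>" and k: "\<delta> * (real k - 1) < 1"
  shows "k\<^sup>2 \<le> card \<U>"
proof -
  \<comment> \<open>For \<open>k = 1\<close> this is \<open>1/0 = 0\<close>; there is then one node only, so that no distance matters.\<close>
  define d where "d = 1 / real (k - 1)"
  define P where "P = (\<lambda>(i,j). (d * real i, d * real j, h (d * real i, d * real j)))"
  define I where "I = {..<k} \<times> {..<k}"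
  have unit: "d * real i \<in> {0..1}" if "i < k" for i
    using that by (cases "k \<le> 1") (auto simp: d_def field_simps of_nat_diff)
  have inGr: "P a \<in> Gr h" if "a \<in> I" for a
    using that unit by (auto simp: P_def I_def Gr_def unit_square_def)
  have "\<exists>U\<in>\<U>. P a \<in> U" if "a \<in> I" for a
    using inGr[OF that] \<U> unfolding fine_cover_def by blast
  then obtain u where u: "\<And>a. a \<in> I \<Longrightarrow> u a \<in> \<U> \<and> P a \<in> u a"
    by metis
  have far: "d * \<bar>real i - real i'\<bar> > \<delta>" if "i < k" "i' < k" "i \<noteq> i'" for i i'
  proof -
    have "real (k - 1) = real k - 1" "real k - 1 > 0"
      using that by (auto simp: of_nat_diff)
    then have "d > \<delta>" and "d > 0"
      using k by (auto simp: d_def field_simps)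
    moreover have "\<bar>real i - real i'\<bar> \<ge> 1"
      using that(3) by linarith
    ultimately show ?thesis
      using mult_left_mono[of 1 "\<bar>real i - real i'\<bar>" d] by linarith
  qed
  have "inj_on u I"
  proof (rule inj_onI)
    fix a b assume ab: "a \<in> I" "b \<in> I" "u a = u b"
    obtain i j where a: "a = (i,j)" by force
    obtain i' j' where b: "b = (i',j')" by force
    have "u a \<in> \<U>" "P a \<in> u a" "P b \<in> u a"
      using u ab by metis+
    then have "dist (P a) (P b) \<le> \<delta>"
      using \<U> diameter_bounded_bound[of "u a" "P a" "P b"] unfolding fine_cover_def by force
    moreover have "\<bar>fst (P a) - fst (P b)\<bar> \<le> dist (P a) (P b)"
      using dist_fst_le[of "P a" "P b"] by (simp add: dist_real_def)
    moreover have "\<bar>fst (snd (P a)) - fst (snd (P b))\<bar> \<le> dist (P a) (P b)"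
      using dist_fst_le[of "snd (P a)" "snd (P b)"] dist_snd_le[of "P a" "P b"]
      by (simp add: dist_real_def)
    moreover have "d \<ge> 0"
      by (simp add: d_def)
    ultimately have "d * \<bar>real i - real i'\<bar> \<le> \<delta>" "d * \<bar>real j - real j'\<bar> \<le> \<delta>"
      by (auto simp: P_def a b abs_mult simp flip: right_diff_distrib)
    then show "a = b"
      using far ab by (force simp: a b I_def)
  qed
  moreover have "u ` I \<subseteq> \<U>" "finite \<U>"
    using u \<U> by (auto simp: fine_cover_def)
  ultimately have "card I \<le> card \<U>"
    by (metis card_image card_mono)
  then show ?thesis
    by (simp add: I_def power2_eq_square)
qed

lemma covering_number_graph_ge:
  fixes h :: "real \<times> real \<Rightarrow> real" and \<delta> :: real
  assumes "bounded (Gr h)" "0 < \<delta>" "\<delta> * (real k - 1) < 1"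
  shows "k\<^sup>2 \<le> covering_number \<delta> (Gr h)"
  using fine_cover_exists[OF assms(1,2)] minimal_fine_cover fine_cover_graph_card_ge assms(3)
  by metis

lemma interval_length_le_cover:
  fixes a b d :: real
  assumes "finite \<V>" "{a..b} \<subseteq> \<Union>\<V>" "\<And>V. V \<in> \<V> \<Longrightarrow> bounded V \<and> diameter V \<le> d" "0 \<le> d"
  shows "b - a \<le> card \<V> * d"
proof -
  let ?J = "\<lambda>V. {Inf V..Inf V + d}"
  have "V \<subseteq> ?J V" if "V \<in> \<V>" for V
  proof
    fix v assume v: "v \<in> V"
    have V: "bounded V" "diameter V \<le> d"
      using assms(3) that by auto
    then have "Inf V \<le> v"
      using v by (intro cInf_lower bounded_imp_bdd_below)
    moreover have "v - d \<le> Inf V"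
    proof (rule cInf_greatest)
      show "V \<noteq> {}" using v by auto
      fix w assume "w \<in> V"
      then have "dist v w \<le> d"
        using diameter_bounded_bound[OF V(1) v] V(2) by force
      then show "v - d \<le> w"
        by (simp add: dist_real_def)
    qed
    ultimately show "v \<in> ?J V"
      by auto
  qed
  then have sub: "{a..b} \<subseteq> (\<Union>V\<in>\<V>. ?J V)"
    using assms(2) by blast
  have "b - a \<le> measure lborel {a..b}"
    by (cases "a \<le> b") auto
  also have "\<dots> \<le> measure lborel (\<Union>V\<in>\<V>. ?J V)"
    using sub assms(1)
    by (intro measure_mono_fmeasurable fmeasurable.finite_UN)
      (auto intro!: fmeasurableI simp: emeasure_lborel_Icc_eq)
  also have "\<dots> \<le> (\<Sum>V\<in>\<V>. measure lborel (?J V))"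
    by (rule measure_UNION_le) (use assms(1) in auto)
  also have "\<dots> = card \<V> * d"
    using assms(4) by simp
  finally show ?thesis .
qed

text \<open>
  A continuous \<open>f\<close> takes on the connected set \<open>A\<close> every value between \<open>f p\<close> and \<open>f q\<close>. The
  covering sets that lie partly over \<open>A\<close>, projected to the vertical axis, therefore cover an interval
  of length \<open>\<bar>f p - f q\<bar>\<close>, and each of them contributes at most its diameter.
\<close>
lemma variation_le_card_over:
  fixes f :: "real \<times> real \<Rightarrow> real" and \<delta> :: real
  assumes \<U>: "fine_cover \<delta> (Gr f) \<U>" and "0 \<le> \<delta>"
    and A: "connected A" "A \<subseteq> unit_square" "continuous_on A f" and pq: "p \<in> A" "q \<in> A"
  shows "\<bar>f p - f q\<bar> \<le> card {U \<in> \<U>. \<exists>x y z. (x, y, z) \<in> U \<and> (x, y) \<in> A} * \<delta>"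
proof -
  let ?W = "{U \<in> \<U>. \<exists>x y z. (x, y, z) \<in> U \<and> (x, y) \<in> A}"
  let ?h = "\<lambda>w::real \<times> real \<times> real. snd (snd w)"
  have fin: "finite ?W"
    using \<U> by (simp add: fine_cover_def)
  have one_sided: "f b - f a \<le> card ?W * \<delta>" if ab: "a \<in> A" "b \<in> A" for a b
  proof -
    have "{f a..f b} \<subseteq> f ` A"
      using connected_contains_Icc[OF connected_continuous_image[OF A(3,1)]] ab by blast
    also have "\<dots> \<subseteq> \<Union>((`) ?h ` ?W)"
    proof
      fix z assume "z \<in> f ` A"
      then obtain x y where xy: "(x, y) \<in> A" "z = f (x, y)"
        by force
      then have "(x, y, z) \<in> Gr f"
        using A(2) by (auto simp: Gr_def)
      then obtain U where "U \<in> \<U>" "(x, y, z) \<in> U"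
        using \<U> by (auto simp: fine_cover_def)
      then show "z \<in> \<Union>((`) ?h ` ?W)"
        using xy(1) by force
    qed
    finally have "f b - f a \<le> card ((`) ?h ` ?W) * \<delta>"
    proof (rule interval_length_le_cover[rotated])
      fix V assume "V \<in> (`) ?h ` ?W"
      then obtain U where V: "V = ?h ` U" and "U \<in> \<U>"
        by auto
      then have U: "bounded U" "diameter U \<le> \<delta>"
        using \<U> by (auto simp: fine_cover_def)
      have "dist (?h v) (?h w) \<le> \<delta>" if "v \<in> U" "w \<in> U" for v w
        using diameter_bounded_bound[OF U(1) that] U(2)
          dist_snd_le[of v w] dist_snd_le[of "snd v" "snd w"] by linarith
      then have "diameter V \<le> \<delta>"
        using assms(2) unfolding V by (intro diameter_le) (auto simp: dist_norm)
      moreover have "bounded V"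
        unfolding V using U(1) by (metis bounded_snd image_image)
      ultimately show "bounded V \<and> diameter V \<le> \<delta>"
        by simp
    qed (use fin assms(2) in auto)
    also have "\<dots> \<le> card ?W * \<delta>"
      using card_image_le[OF fin, of "(`) ?h"] assms(2) by (intro mult_right_mono) auto
    finally show ?thesis .
  qed
  show ?thesis
    using one_sided[OF pq] one_sided[OF pq(2,1)] by (simp add: abs_if)
qed

section \<open>The grid of side 1/n\<close>

definition cell :: "nat \<Rightarrow> nat \<times> nat \<Rightarrow> (real \<times> real) set" where
  "cell n = (\<lambda>(i, j). {i/n..(i+1)/n} \<times> {j/n..(j+1)/n})"

definition cells :: "nat \<Rightarrow> (nat \<times> nat) set" where
  "cells n = {..<n} \<times> {..<n}"

text \<open>
  A set of diameter at most the side of the grid lies over few cells: two indices that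
  occur differ by at most 2 in each coordinate, which leaves \<open>5 * 5\<close> indices around any one of them.
  The translation by \<open>w\<close> keeps the bound and is what the estimate under the convolution integral
  needs.
\<close>
lemma card_cells_over_le:
  fixes w :: "real \<times> real"
  assumes n: "n > 0" and U: "bounded U" "diameter U \<le> 1/n"
  shows "card {c \<in> cells n. \<exists>x y z. (x, y, z) \<in> U \<and> (x, y) + w \<in> cell n c} \<le> 25"
    (is "card ?S \<le> 25")
proof (cases "?S = {}")
  case False
  obtain s t where w: "w = (s, t)" by force
  from False obtain i j x y z where ij: "(x, y, z) \<in> U" "(x, y) + w \<in> cell n (i, j)"
    by auto
  have close: "i' \<in> {i - 2..i + 2}"
    if "real i / n \<le> r" "r \<le> (real i + 1) / n" "real i' / n \<le> r'" "r' \<le> (real i' + 1) / n"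
       "\<bar>r - r'\<bar> \<le> 1/n" for i i' :: nat and r r' :: real
  proof -
    have "real i \<le> r * n" "r * n \<le> real i + 1" "real i' \<le> r' * n" "r' * n \<le> real i' + 1"
      using that n by (simp_all add: field_simps)
    moreover have "\<bar>r * n - r' * n\<bar> \<le> 1"
      using that(5) n by (simp add: pos_le_divide_eq abs_mult flip: left_diff_distrib)
    ultimately have "\<bar>real i - real i'\<bar> \<le> 2"
      by linarith
    then show ?thesis
      by auto
  qed
  have "?S \<subseteq> {i - 2..i + 2} \<times> {j - 2..j + 2}"
  proof
    fix c assume "c \<in> ?S"
    then obtain i' j' x' y' z' where c: "c = (i', j')"
      and ij': "(x', y', z') \<in> U" "(x', y') + w \<in> cell n (i', j')"
      by (cases c) auto
    have "dist (x, y, z) (x', y', z') \<le> 1/n"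
      using diameter_bounded_bound[OF U(1) ij(1) ij'(1)] U(2) by linarith
    then have "\<bar>x - x'\<bar> \<le> 1/n" "\<bar>y - y'\<bar> \<le> 1/n"
      using dist_fst_le[of "(x, y, z)" "(x', y', z')"] dist_snd_le[of "(x, y, z)" "(x', y', z')"]
        dist_fst_le[of "(y, z)" "(y', z')"] by (auto simp: dist_real_def)
    then have "i' \<in> {i - 2..i + 2}" "j' \<in> {j - 2..j + 2}"
      using ij(2) ij'(2) close[of i "x + s" i' "x' + s"] close[of j "y + t" j' "y' + t"]
      by (auto simp: cell_def w add_ac)
    then show "c \<in> {i - 2..i + 2} \<times> {j - 2..j + 2}"
      by (simp add: c)
  qed
  then have "card ?S \<le> card ({i - 2..i + 2} \<times> {j - 2..j + 2})"
    by (rule card_mono[rotated]) auto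
  also have "\<dots> \<le> 5 * 5"
    unfolding card_cartesian_product by (intro mult_mono) auto
  finally show ?thesis
    by simp
qed (metis card.empty zero_le)

lemma unit_square_cells:
  assumes "n > 0"
  shows "unit_square = (\<Union>c\<in>cells n. cell n c)"
proof (intro subset_antisym subsetI)
  have *: "\<exists>i<n. real i / n \<le> r \<and> r \<le> (real i + 1) / n" if "0 \<le> r" "r \<le> 1" for r :: real
  proof (cases "r = 1")
    case True
    then show ?thesis
      using assms by (intro exI[of _ "n - 1"]) (auto simp: of_nat_diff field_simps)
  next
    case False
    define i where "i = nat \<lfloor>r * n\<rfloor>"
    have i: "real i \<le> r * n" "r * n \<le> real i + 1"
      using that by (auto simp: i_def of_nat_nat)
    have "r * n < n"
      using that False assms by simp
    then have "i < n"
      using i by linarith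
    then show ?thesis
      using i assms by (intro exI[of _ i]) (simp add: pos_divide_le_eq pos_le_divide_eq)
  qed
  fix a assume "a \<in> unit_square"
  then show "a \<in> (\<Union>c\<in>cells n. cell n c)"
    using *[of "fst a"] *[of "snd a"]
    by (fastforce simp: unit_square_def cells_def cell_def mem_Times_iff add_ac)
next
  fix a assume "a \<in> (\<Union>c\<in>cells n. cell n c)"
  then obtain i j where ij: "i < n" "j < n" "a \<in> cell n (i, j)"
    by (auto simp: cells_def)
  have "0 \<le> real i / n" "0 \<le> real j / n"
    and le1: "(real i + 1) / n \<le> 1" "(real j + 1) / n \<le> 1"
    using ij by (simp_all add: field_simps)
  moreover have a: "real i / n \<le> fst a" "fst a \<le> (real i + 1) / n"
    "real j / n \<le> snd a" "snd a \<le> (real j + 1) / n"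
    using ij(3) by (auto simp: cell_def mem_Times_iff add.commute)
  ultimately have "0 \<le> fst a" "0 \<le> snd a"
    by (blast intro: order_trans)+
  then show "a \<in> unit_square"
    using order_trans[OF a(2) le1(1)] order_trans[OF a(4) le1(2)]
    by (simp add: unit_square_def mem_Times_iff)
qed

section \<open>Variation of the translated function\<close>

definition zero_extension :: "(real \<times> real \<Rightarrow> real) \<Rightarrow> real \<times> real \<Rightarrow> real" where
  "zero_extension f p = indicator unit_square p * f p"

text \<open>
  A line parallel to an axis at distance \<open>s\<close> meets only one column (or row) of the grid, except when
  it runs between two of them. The strict inequality leaves out the one whose lower edge is the line,
  since that one lies entirely on the upper side.
\<close>
lemma card_layer_le:
  fixes s :: real
  assumes "n > 0"
  shows "card {i \<in> {..<n}. real i / n < s \<and> s \<le> (real i + 1) / n} \<le> 1"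
proof -
  have "i = nat (\<lceil>n * s\<rceil> - 1)" if "real i / n < s" "s \<le> (real i + 1) / n" for i
  proof -
    have "real i < n * s" "n * s \<le> real i + 1"
      using that assms by (simp_all add: pos_divide_less_eq pos_le_divide_eq mult.commute)
    then have "\<lceil>n * s\<rceil> = int i + 1"
      by (intro ceiling_unique) auto
    then show ?thesis by simp
  qed
  then have "{i \<in> {..<n}. real i / n < s \<and> s \<le> (real i + 1) / n} \<subseteq> {nat (\<lceil>n * s\<rceil> - 1)}"
    by blast
  then show ?thesis
    using card_mono[OF finite.insertI[OF finite.emptyI]] by fastforce
qed

text \<open>
  The bound is uniform in the translation \<open>w\<close>. A translated cell that lies inside the unit square
  has the variation of \<open>f\<close>, which the number of covering sets over it controls; summed over
  the cells this gives the first term, as no covering set counts for more than 25 cells. Translated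
  cells outside contribute nothing. The zero extension may jump across the edges \<open>x = 0\<close> and
  \<open>y = 0\<close>, but this affects at most one column and one row of cells, that is at most
  \<open>2 * n\<close> cells with variation at most \<open>2 * M\<close> each.

  The points \<open>p c\<close> and \<open>q c\<close> stand for near-extremal points of a cell. Working with chosen points
  rather than with the oscillation over the cell makes the left-hand side visibly measurable in \<open>w\<close>.
\<close>
lemma sum_translated_variation_le:
  fixes f :: "real \<times> real \<Rightarrow> real" and p q :: "nat \<times> nat \<Rightarrow> real \<times> real"
  assumes f: "continuous_on unit_square f" and M: "\<And>a. a \<in> unit_square \<Longrightarrow> \<bar>f a\<bar> \<le> M"
    and n: "n > 0" and \<U>: "fine_cover (1/n) (Gr f) \<U>"
    and pq: "\<And>c. c \<in> cells n \<Longrightarrow> p c \<in> cell n c \<and> q c \<in> cell n c"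
    and w: "0 \<le> fst w" "0 \<le> snd w"
  shows "(\<Sum>c\<in>cells n. \<bar>zero_extension f (p c - w) - zero_extension f (q c - w)\<bar>)
           \<le> 25 * card \<U> / n + 4 * M * n"
proof -
  obtain s t where st: "w = (s, t)" "0 \<le> s" "0 \<le> t"
    using w by (cases w) auto
  define k where "k c = card {U \<in> \<U>. \<exists>x y z. (x, y, z) \<in> U \<and> (x, y) + w \<in> cell n c}" for c
  define L where "L s = {i \<in> {..<n}. real i / n < s \<and> s \<le> (real i + 1) / n}" for s
  define B where "B = L s \<times> {..<n} \<union> {..<n} \<times> L t"
  have fin: "finite (cells n)" "finite (L s)" "finite (L t)" "finite \<U>"
    using \<U> by (auto simp: cells_def L_def fine_cover_def)
  have M0: "0 \<le> M"
    using M[of "(0,0)"] by (force simp: unit_square_def)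
  have F: "\<bar>zero_extension f a\<bar> \<le> M" for a
    using M M0 by (auto simp: zero_extension_def indicator_def)
  have bound: "\<bar>zero_extension f (p c - w) - zero_extension f (q c - w)\<bar>
      \<le> k c * (1/n) + (if c \<in> B then 2 * M else 0)" if c: "c \<in> cells n" for c
  proof -
    obtain i j where ij: "c = (i, j)" "i < n" "j < n"
      using c by (auto simp: cells_def)
    let ?A = "{real i / n - s..(real i + 1) / n - s} \<times> {real j / n - t..(real j + 1) / n - t}"
    have in_A: "p c - w \<in> ?A" "q c - w \<in> ?A"
      using pq[OF c] by (auto simp: cell_def ij st(1) mem_Times_iff)
    have k0: "0 \<le> k c * (1 / real n)"
      by simp
    \<comment> \<open>As \<open>w\<close> is nonnegative, a translated cell can leave the unit square only on the left or
      below: it is cut by an edge, or inside, or outside.\<close>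
    consider "c \<in> B" | "s \<le> real i / n" "t \<le> real j / n"
      | "(real i + 1) / n < s \<or> (real j + 1) / n < t"
      using ij unfolding B_def L_def by (force simp: not_le not_less)
    then show ?thesis
    proof cases
      case 1
      then show ?thesis
        using F[of "p c - w"] F[of "q c - w"] k0 by (simp only: if_True)
    next
      case 2
      have "(real i + 1) / n \<le> 1" "(real j + 1) / n \<le> 1"
        using ij n by (simp_all add: field_simps)
      then have A: "?A \<subseteq> unit_square"
        using 2 st(2,3) by (auto simp: unit_square_def)
      have "\<bar>f (p c - w) - f (q c - w)\<bar>
          \<le> card {U \<in> \<U>. \<exists>x y z. (x, y, z) \<in> U \<and> (x, y) \<in> ?A} * (1/n)"
        by (rule variation_le_card_over[OF \<U> _ _ A])
          (use in_A continuous_on_subset[OF f A] in \<open>auto intro!: connected_Times\<close>)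
      also have "{U \<in> \<U>. \<exists>x y z. (x, y, z) \<in> U \<and> (x, y) \<in> ?A}
          = {U \<in> \<U>. \<exists>x y z. (x, y, z) \<in> U \<and> (x, y) + w \<in> cell n c}"
        by (simp add: cell_def ij(1) st(1) le_diff_eq diff_le_eq)
      also have "card \<dots> = k c"
        by (simp add: k_def)
      finally have "\<bar>zero_extension f (p c - w) - zero_extension f (q c - w)\<bar> \<le> k c * (1/n)"
        using subsetD[OF A in_A(1)] subsetD[OF A in_A(2)] by (simp add: zero_extension_def)
      then show ?thesis
        using M0 by auto
    next
      case 3
      then have "p c - w \<notin> unit_square" "q c - w \<notin> unit_square"
        using in_A by (auto simp: unit_square_def mem_Times_iff)
      then show ?thesis
        using M0 by (simp add: zero_extension_def)
    qed
  qed
  \<comment> \<open>Double counting of the pairs of a cell and a covering set that lies partly over it.\<close>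
  have "(\<Sum>c\<in>cells n. k c) = (\<Sum>c\<in>cells n. \<Sum>U\<in>\<U>.
      if \<exists>x y z. (x, y, z) \<in> U \<and> (x, y) + w \<in> cell n c then 1 else 0)"
    unfolding k_def using fin by (simp add: sum.If_cases Int_def)
  also have "\<dots> = (\<Sum>U\<in>\<U>. card {c \<in> cells n. \<exists>x y z. (x, y, z) \<in> U \<and> (x, y) + w \<in> cell n c})"
    using fin by (subst sum.swap) (simp add: sum.If_cases Int_def)
  also have "\<dots> \<le> (\<Sum>U\<in>\<U>. 25)"
    using \<U> card_cells_over_le[OF n, of _ w] unfolding fine_cover_def
    by (intro sum_mono) blast
  finally have sum_k: "(\<Sum>c\<in>cells n. k c) \<le> 25 * card \<U>"
    by simp
  have "card B \<le> card (L s) * n + n * card (L t)"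
    unfolding B_def by (rule order_trans[OF card_Un_le]) (simp add: card_cartesian_product)
  also have "\<dots> \<le> 1 * n + n * 1"
    using card_layer_le[OF n] unfolding L_def by (intro add_mono mult_mono) auto
  finally have card_B: "card B \<le> 2 * n"
    by simp
  have "(\<Sum>c\<in>cells n. \<bar>zero_extension f (p c - w) - zero_extension f (q c - w)\<bar>)
      \<le> (\<Sum>c\<in>cells n. k c * (1/n) + (if c \<in> B then 2 * M else 0))"
    by (intro sum_mono bound)
  also have "\<dots> = real (\<Sum>c\<in>cells n. k c) * (1/n) + 2 * M * card (cells n \<inter> B)"
    using fin by (simp add: sum.distrib sum_distrib_right sum.If_cases sum_divide_distrib)
  also have "\<dots> \<le> real (25 * card \<U>) * (1/n) + 2 * M * (2 * n)"
  proof (intro add_mono mult_right_mono mult_left_mono)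
    have "card (cells n \<inter> B) \<le> card B"
      using fin by (intro card_mono) (auto simp: B_def)
    then show "real (card (cells n \<inter> B)) \<le> real (2 * n)"
      using card_B by linarith
  qed (use sum_k M0 in \<open>auto simp flip: of_nat_sum\<close>)
  finally show ?thesis
    by simp
qed

section \<open>Covering a graph by its variation on the cells\<close>

text \<open>
  Over each cell the graph lies in a column whose height is the oscillation of \<open>g\<close>
  there, and a stack of cubes of side \<open>1/n\<close> fills this column. The cubes have diameter
  \<open>sqrt 3 / n\<close>, hence the \<open>2/n\<close>. Rounding the number of cubes up costs one cube per cell,
  and replacing the oscillation by the variation between two points, since the supremum need not be
  attained, costs another one: these are the \<open>2 * n\<^sup>2\<close>.
\<close>
lemma covering_number_graph_le_variation:
  fixes g :: "real \<times> real \<Rightarrow> real"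
  assumes g: "bounded (g ` unit_square)" and n: "n > 0"
  obtains p q where "\<And>c. c \<in> cells n \<Longrightarrow> p c \<in> cell n c \<and> q c \<in> cell n c"
    and "real (covering_number (2/n) (Gr g))
      \<le> n * (\<Sum>c\<in>cells n. \<bar>g (p c) - g (q c)\<bar>) + 2 * (real n)\<^sup>2"
proof -
  define D where "D c = diameter (g ` cell n c)" for c
  define m where "m c = Inf (g ` cell n c)" for c
  define box where "box c k = {(x, y, z). (x, y) \<in> cell n c \<and> z \<in> {m c + k/n..m c + (k+1)/n}}"
    for c and k :: nat
  define K where "K c = {..nat \<lfloor>n * D c\<rfloor>}" for c
  have bdd: "bounded (g ` cell n c)" if "c \<in> cells n" for c
    by (rule bounded_subset[OF g]) (use unit_square_cells[OF n] that in blast)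
  have D0: "0 \<le> D c" if "c \<in> cells n" for c
    unfolding D_def using bdd[OF that] by (rule diameter_ge_0)
  have "\<exists>a b. a \<in> cell n c \<and> b \<in> cell n c \<and> D c \<le> \<bar>g a - g b\<bar> + 1/n" if c: "c \<in> cells n" for c
  proof (cases "D c - 1/n > 0")
    case True
    then obtain a b where "a \<in> cell n c" "b \<in> cell n c" "D c - 1/n < dist (g a) (g b)"
      using diameter_lower_bounded[OF bdd[OF c], of "D c - 1/n"] n by (auto simp: D_def)
    then show ?thesis
      by (intro exI[of _ a] exI[of _ b]) (auto simp: dist_real_def)
  next
    case False
    have "(fst c / n, snd c / n) \<in> cell n c"
      using n by (auto simp: cell_def case_prod_beta divide_right_mono)
    then show ?thesis
      using False by force
  qed
  then obtain p q where pq: "\<And>c. c \<in> cells n \<Longrightarrow> p c \<in> cell n c \<and> q c \<in> cell n c"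
    and D: "\<And>c. c \<in> cells n \<Longrightarrow> D c \<le> \<bar>g (p c) - g (q c)\<bar> + 1/n"
    by metis
  define \<U> where "\<U> = (\<Union>c\<in>cells n. box c ` K c)"
  have fin: "finite (cells n)"
    by (simp add: cells_def)
  have "fine_cover (2/n) (Gr g) \<U>"
    unfolding fine_cover_def
  proof (intro conjI ballI)
    show "finite \<U>"
      using fin by (auto simp: \<U>_def K_def)
    show "Gr g \<subseteq> \<Union>\<U>"
    proof
      fix v assume "v \<in> Gr g"
      then obtain x y where v: "v = (x, y, g (x, y))" "(x, y) \<in> unit_square"
        by (auto simp: Gr_def)
      then obtain c where c: "c \<in> cells n" "(x, y) \<in> cell n c"
        using unit_square_cells[OF n] by blast
      have in_g: "g (x, y) \<in> g ` cell n c"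
        using c by blast
      have "m c \<le> g (x, y)"
        unfolding m_def by (rule cInf_lower[OF in_g bounded_imp_bdd_below[OF bdd[OF c(1)]]])
      moreover have "g (x, y) - D c \<le> m c"
        unfolding m_def
      proof (rule cInf_greatest)
        fix z assume "z \<in> g ` cell n c"
        then have "dist (g (x, y)) z \<le> D c"
          unfolding D_def by (rule diameter_bounded_bound[OF bdd[OF c(1)] in_g])
        then show "g (x, y) - D c \<le> z"
          by (simp add: dist_real_def)
      qed (use in_g in auto)
      ultimately have r: "0 \<le> n * (g (x, y) - m c)" "n * (g (x, y) - m c) \<le> n * D c"
        by (auto intro: mult_left_mono)
      define k where "k = nat \<lfloor>n * (g (x, y) - m c)\<rfloor>"
      have "k \<in> K c"
        using r by (auto simp: K_def k_def intro!: nat_mono floor_mono)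
      moreover have "real k \<le> n * (g (x, y) - m c)" "n * (g (x, y) - m c) \<le> real k + 1"
        using r(1) by (auto simp: k_def of_nat_nat)
      then have "real k / n \<le> g (x, y) - m c" "g (x, y) - m c \<le> (real k + 1) / n"
        using n by (simp_all add: pos_divide_le_eq pos_le_divide_eq mult.commute)
      then have "v \<in> box c k"
        using c(2) by (auto simp: box_def v(1) add_ac)
      ultimately show "v \<in> \<Union>\<U>"
        using c(1) by (auto simp: \<U>_def)
    qed
    fix U assume "U \<in> \<U>"
    then obtain i j k where U: "U = box (i, j) k"
      by (auto simp: \<U>_def)
    have dist: "dist v v' \<le> 2/n" if vv': "v \<in> U" "v' \<in> U" for v v'
    proof -
      obtain x y z x' y' z' where v: "v = (x, y, z)" "v' = (x', y', z')"
        by (metis surj_pair)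
      have "\<bar>x - x'\<bar> \<le> 1/n" "\<bar>y - y'\<bar> \<le> 1/n" "\<bar>z - z'\<bar> \<le> 1/n"
        using vv' by (auto simp: U v box_def cell_def add_divide_distrib)
      then have "(x - x')\<^sup>2 \<le> (1/n)\<^sup>2" "(y - y')\<^sup>2 \<le> (1/n)\<^sup>2" "(z - z')\<^sup>2 \<le> (1/n)\<^sup>2"
        by (simp_all add: abs_le_square_iff[symmetric])
      moreover have "(2/n)\<^sup>2 = 4 * (1/real n)\<^sup>2"
        by (simp add: power2_eq_square)
      ultimately have "(x - x')\<^sup>2 + ((y - y')\<^sup>2 + (z - z')\<^sup>2) \<le> (2/n)\<^sup>2"
        using zero_le_power2[of "1/real n"] by linarith
      then show ?thesis
        unfolding v dist_Pair_Pair by (intro real_le_lsqrt) (auto simp: dist_real_def)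
    qed
    show "bounded U"
    proof (cases "U = {}")
      case False
      then obtain v where "v \<in> U" by blast
      then show ?thesis
        using dist unfolding bounded_def by blast
    qed simp
    show "diameter U \<le> 2/n"
      using dist by (intro diameter_le) (auto simp: dist_norm)
  qed
  then have "covering_number (2/n) (Gr g) \<le> card \<U>"
    by (rule covering_number_le_card)
  also have "card \<U> \<le> (\<Sum>c\<in>cells n. card (box c ` K c))"
    unfolding \<U>_def by (rule card_UN_le[OF fin])
  also have "\<dots> \<le> (\<Sum>c\<in>cells n. card (K c))"
    by (intro sum_mono card_image_le) (simp add: K_def)
  finally have "real (covering_number (2/n) (Gr g)) \<le> (\<Sum>c\<in>cells n. real (card (K c)))"
    by (metis of_nat_mono of_nat_sum)
  also have "\<dots> \<le> (\<Sum>c\<in>cells n. n * \<bar>g (p c) - g (q c)\<bar> + 2)"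
  proof (rule sum_mono)
    fix c assume c: "c \<in> cells n"
    have "real (card (K c)) = of_int \<lfloor>n * D c\<rfloor> + 1"
      using D0[OF c] by (simp add: K_def of_nat_nat)
    also have "\<dots> \<le> n * D c + 1"
      by simp
    also have "n * D c \<le> n * (\<bar>g (p c) - g (q c)\<bar> + 1/n)"
      using D[OF c] by (intro mult_left_mono) auto
    also have "\<dots> = n * \<bar>g (p c) - g (q c)\<bar> + 1"
      using n by (simp add: distrib_left)
    finally show "real (card (K c)) \<le> n * \<bar>g (p c) - g (q c)\<bar> + 2"
      by simp
  qed
  also have "\<dots> = n * (\<Sum>c\<in>cells n. \<bar>g (p c) - g (q c)\<bar>) + 2 * (real n)\<^sup>2"
    by (simp add: sum.distrib sum_distrib_left cells_def power2_eq_square)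
  finally show ?thesis
    using that pq by blast
qed

section \<open>Convolution with an integrable kernel\<close>

lemma bounded_Gr:
  assumes "bounded (g ` unit_square)"
  shows "bounded (Gr g)"
proof (rule bounded_subset)
  show "bounded ({0..1::real} \<times> {0..1::real} \<times> g ` unit_square)"
    using assms by (intro bounded_Times bounded_closed_interval)
  show "Gr g \<subseteq> {0..1} \<times> {0..1} \<times> g ` unit_square"
    by (auto simp: Gr_def unit_square_def)
qed

lemma bounded_image_unit_square:
  fixes f :: "real \<times> real \<Rightarrow> real"
  assumes "continuous_on unit_square f"
  shows "bounded (f ` unit_square)"
proof -
  have "compact unit_square"
    unfolding unit_square_def by (intro compact_Times) auto
  then show ?thesis
    using assms by (intro compact_imp_bounded compact_continuous_image)
qed

lemma measurable_zero_extension: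
  assumes "continuous_on unit_square f"
  shows "zero_extension f \<in> borel_measurable borel"
proof -
  have "closed unit_square"
    unfolding unit_square_def by (intro closed_Times) auto
  then have "(\<lambda>p. indicator unit_square p *\<^sub>R f p) \<in> borel_measurable borel"
    using assms by (intro borel_measurable_continuous_on_indicator) auto
  then show ?thesis
    by (simp add: zero_extension_def[abs_def])
qed

lemma integrable_kernel_zero_extension:
  fixes K f :: "real \<times> real \<Rightarrow> real"
  assumes f: "continuous_on unit_square f" and K: "integrable lborel K"
  shows "integrable lborel (\<lambda>w. K w * zero_extension f (p - w))"
proof -
  obtain M where M: "\<And>a. a \<in> unit_square \<Longrightarrow> \<bar>f a\<bar> \<le> M"
    using bounded_image_unit_square[OF f] by (auto simp: bounded_iff)
  have F: "\<bar>zero_extension f a\<bar> \<le> \<bar>M\<bar>" for a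
    using M[of a] by (auto simp: zero_extension_def indicator_def)
  note [measurable] = measurable_zero_extension[OF f] borel_measurable_integrable[OF K]
  show ?thesis
  proof (rule Bochner_Integration.integrable_bound)
    show "integrable lborel (\<lambda>w. \<bar>M\<bar> * K w)"
      using K by simp
    show "(\<lambda>w. K w * zero_extension f (p - w)) \<in> borel_measurable lborel"
      by measurable
    show "AE w in lborel. norm (K w * zero_extension f (p - w)) \<le> norm (\<bar>M\<bar> * K w)"
    proof (rule AE_I2)
      show "norm (K w * zero_extension f (p - w)) \<le> norm (\<bar>M\<bar> * K w)" for w
        using mult_left_mono[OF F[of "p - w"] abs_ge_zero[of "K w"]] by (simp add: abs_mult mult.commute)
    qed
  qed
qed

text \<open>
  By the triangle inequality, the variation of \<open>g\<close> along chosen pairs of points is at most the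
  integral, against \<open>\<bar>K\<bar>\<close>, of the variations of the translates of the zero extension of \<open>f\<close>, and
  these all obey the same bound. The terms of order \<open>n\<^sup>2\<close> that arise
  from the edges of the square and from rounding are absorbed in the covering number of the graph
  of \<open>f\<close>, which is itself at least \<open>n\<^sup>2\<close>.
\<close>
lemma convolution_covering_number_le:
  fixes K f g :: "real \<times> real \<Rightarrow> real"
  assumes f: "continuous_on unit_square f" and K: "integrable lborel K"
    and supp: "\<And>w. K w \<noteq> 0 \<Longrightarrow> 0 \<le> fst w \<and> 0 \<le> snd w"
    and g: "\<And>p. p \<in> unit_square \<Longrightarrow> g p = (LINT w|lborel. K w * zero_extension f (p - w))"
  shows "bounded (g ` unit_square)"
    and "\<exists>C>0. \<forall>n>0. real (covering_number (2 / real n) (Gr g))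
      \<le> C * real (covering_number (1 / real n) (Gr f))"
proof -
  obtain M where M: "\<And>a. a \<in> unit_square \<Longrightarrow> \<bar>f a\<bar> \<le> M"
    using bounded_image_unit_square[OF f] by (auto simp: bounded_iff)
  have M0: "0 \<le> M"
    using M[of "(0,0)"] by (force simp: unit_square_def)
  have F: "\<bar>zero_extension f a\<bar> \<le> M" for a
    using M[of a] M0 by (auto simp: zero_extension_def indicator_def)
  define L where "L = (LINT w|lborel. \<bar>K w\<bar>)"
  have L0: "0 \<le> L"
    by (simp add: L_def)
  note int = integrable_kernel_zero_extension[OF f K]
  have "\<bar>g p\<bar> \<le> M * L" if "p \<in> unit_square" for p
  proof -
    have "\<bar>g p\<bar> \<le> (LINT w|lborel. \<bar>K w * zero_extension f (p - w)\<bar>)"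
      unfolding g[OF that] by (rule integral_abs_bound)
    also have "\<dots> \<le> (LINT w|lborel. M * \<bar>K w\<bar>)"
    proof (rule integral_mono)
      show "\<bar>K w * zero_extension f (p - w)\<bar> \<le> M * \<bar>K w\<bar>" for w
        using mult_left_mono[OF F[of "p - w"] abs_ge_zero[of "K w"]] by (simp add: abs_mult mult.commute)
    qed (use int[of p] K in auto)
    finally show ?thesis
      by (simp add: L_def)
  qed
  then show bdd: "bounded (g ` unit_square)"
    unfolding bounded_iff by (intro exI[of _ "M * L"]) auto
  define C where "C = L * (25 + 4 * M) + 2"
  have "real (covering_number (2 / n) (Gr g)) \<le> C * covering_number (1 / n) (Gr f)"
    if n: "n > 0" for n :: nat
  proof -
    define N where "N = covering_number (1 / n) (Gr f)"
    have "bounded (Gr f)"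
      using bounded_Gr[OF bounded_image_unit_square[OF f]] .
    then obtain \<U> where \<U>: "fine_cover (1/n) (Gr f) \<U>" "card \<U> = N"
      unfolding N_def using fine_cover_exists minimal_fine_cover n
      by (metis divide_pos_pos of_nat_0_less_iff zero_less_one)
    have "n\<^sup>2 \<le> N"
      using fine_cover_graph_card_ge[OF \<U>(1), of n] \<U>(2) n by (simp add: field_simps)
    then have N: "(real n)\<^sup>2 \<le> N"
      by (metis of_nat_le_iff of_nat_power)
    obtain p q where pq: "\<And>c. c \<in> cells n \<Longrightarrow> p c \<in> cell n c \<and> q c \<in> cell n c"
      and cov: "real (covering_number (2/n) (Gr g))
        \<le> n * (\<Sum>c\<in>cells n. \<bar>g (p c) - g (q c)\<bar>) + 2 * (real n)\<^sup>2"
      using covering_number_graph_le_variation[OF bdd n] by blast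
    define B where "B = 25 * real N / n + 4 * M * n"
    let ?\<Delta> = "\<lambda>c w. zero_extension f (p c - w) - zero_extension f (q c - w)"
    have int\<Delta>: "integrable lborel (\<lambda>w. K w * ?\<Delta> c w)" for c
      using int[of "p c"] int[of "q c"] by (simp add: right_diff_distrib)
    have "(\<Sum>c\<in>cells n. \<bar>g (p c) - g (q c)\<bar>)
        \<le> (\<Sum>c\<in>cells n. LINT w|lborel. \<bar>K w * ?\<Delta> c w\<bar>)"
    proof (rule sum_mono)
      fix c assume "c \<in> cells n"
      then have "p c \<in> unit_square" "q c \<in> unit_square"
        using pq unit_square_cells[OF n] by blast+
      then have "g (p c) - g (q c) = (LINT w|lborel. K w * ?\<Delta> c w)"
        using int by (simp add: g right_diff_distrib)
      then show "\<bar>g (p c) - g (q c)\<bar> \<le> (LINT w|lborel. \<bar>K w * ?\<Delta> c w\<bar>)"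
        using integral_abs_bound by metis
    qed
    also have "\<dots> = (LINT w|lborel. (\<Sum>c\<in>cells n. \<bar>K w * ?\<Delta> c w\<bar>))"
      using int\<Delta> by (intro Bochner_Integration.integral_sum[symmetric]) auto
    also have "\<dots> \<le> (LINT w|lborel. B * \<bar>K w\<bar>)"
    proof (rule integral_mono)
      show "(\<Sum>c\<in>cells n. \<bar>K w * ?\<Delta> c w\<bar>) \<le> B * \<bar>K w\<bar>" for w
      proof (cases "K w = 0")
        case False
        then have "(\<Sum>c\<in>cells n. \<bar>?\<Delta> c w\<bar>) \<le> B"
          using sum_translated_variation_le[OF f M n \<U>(1) pq] supp[of w] \<U>(2)
          by (simp add: B_def)
        then have "\<bar>K w\<bar> * (\<Sum>c\<in>cells n. \<bar>?\<Delta> c w\<bar>) \<le> \<bar>K w\<bar> * B"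
          by (rule mult_left_mono) simp
        then show ?thesis
          by (simp add: abs_mult mult.commute flip: sum_distrib_left)
      qed simp
      show "integrable lborel (\<lambda>w. \<Sum>c\<in>cells n. \<bar>K w * ?\<Delta> c w\<bar>)"
        by (intro Bochner_Integration.integrable_sum integrable_abs int\<Delta>)
      show "integrable lborel (\<lambda>w. B * \<bar>K w\<bar>)"
        by (intro integrable_mult_right integrable_abs K)
    qed
    also have "\<dots> = L * B"
      by (simp add: L_def)
    finally have "n * (\<Sum>c\<in>cells n. \<bar>g (p c) - g (q c)\<bar>) \<le> n * (L * B)"
      by (intro mult_left_mono) auto
    also have "\<dots> = L * (25 * N + 4 * M * (real n)\<^sup>2)"
      using n by (simp add: B_def power2_eq_square field_simps)
    also have "\<dots> \<le> L * (25 * N + 4 * M * N)"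
      using N L0 M0 by (intro mult_left_mono add_left_mono) auto
    finally have "real (covering_number (2/n) (Gr g)) \<le> L * (25 * N + 4 * M * N) + 2 * N"
      using cov N by linarith
    also have "\<dots> = C * N"
      by (simp add: C_def algebra_simps)
    finally show ?thesis
      by (simp add: N_def)
  qed
  moreover have "C > 0"
    using L0 M0 by (simp add: C_def add_nonneg_pos)
  ultimately show "\<exists>C>0. \<forall>n>0. real (covering_number (2 / real n) (Gr g))
      \<le> C * real (covering_number (1 / real n) (Gr f))"
    by blast
qed

section \<open>The mixed Riemann-Liouville integral as a convolution\<close>

text \<open>
  Cutting the kernel off at 1 makes it integrable over the line for \<open>\<gamma> > 0\<close>. The cut-off does not change the
  fractional integral on the unit square, where the variable \<open>x - u\<close> never exceeds 1.
\<close>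
definition RL_kernel :: "real \<Rightarrow> real \<Rightarrow> real" where
  "RL_kernel \<gamma> s = indicator {0..1} s * s powr (\<gamma> - 1)"

lemma RL_kernel_integrable:
  assumes "\<gamma> > 0"
  shows "integrable lborel (RL_kernel \<gamma>)"
proof -
  have "(\<lambda>s. s powr (\<gamma> - 1)) integrable_on {0..1::real}"
    by (rule integrable_on_powr_from_0) (use assms in auto)
  then have "(\<lambda>s. s powr (\<gamma> - 1)) absolutely_integrable_on {0..1::real}"
    by (subst absolutely_integrable_on_iff_nonneg) auto
  then have "integrable lebesgue (RL_kernel \<gamma>)"
    by (simp add: set_integrable_def RL_kernel_def[abs_def])
  moreover have "RL_kernel \<gamma> \<in> borel_measurable lborel"
    unfolding RL_kernel_def[abs_def] by measurable
  ultimately show ?thesis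
    by (simp add: integrable_completion)
qed

lemma integrable_lborel_tensor:
  fixes k l :: "real \<Rightarrow> real"
  assumes [measurable]: "integrable lborel k" "integrable lborel l"
  shows "integrable lborel (\<lambda>w. k (fst w) * l (snd w))"
proof -
  have [measurable]: "k \<in> borel_measurable borel" "l \<in> borel_measurable borel"
    using assms by (auto dest: borel_measurable_integrable)
  have "integrable (lborel \<Otimes>\<^sub>M lborel) (\<lambda>w. k (fst w) * l (snd w))"
  proof (rule lborel_pair.Fubini_integrable)
    show "(\<lambda>w. k (fst w) * l (snd w)) \<in> borel_measurable (lborel \<Otimes>\<^sub>M lborel)"
      by measurable
    show "integrable lborel (\<lambda>x. LINT y|lborel. norm (k (fst (x, y)) * l (snd (x, y))))"
      using assms by (simp add: abs_mult)
    show "AE x in lborel. integrable lborel (\<lambda>y. k (fst (x, y)) * l (snd (x, y)))"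
      using assms by simp
  qed
  then show ?thesis
    by (simp add: lborel_prod)
qed

definition mixed_RL_kernel :: "real \<Rightarrow> real \<Rightarrow> real \<times> real \<Rightarrow> real" where
  "mixed_RL_kernel \<alpha> \<beta> w =
     1 / (Gamma \<alpha> * Gamma \<beta>) * (RL_kernel \<alpha> (fst w) * RL_kernel \<beta> (snd w))"

lemma mixed_RL_kernel_integrable:
  assumes "\<alpha> > 0" "\<beta> > 0"
  shows "integrable lborel (mixed_RL_kernel \<alpha> \<beta>)"
  unfolding mixed_RL_kernel_def[abs_def]
  using integrable_lborel_tensor[OF RL_kernel_integrable RL_kernel_integrable] assms
  by (intro integrable_mult_right) auto

text \<open>
  Substitute \<open>u = x - s\<close> and \<open>v = y - t\<close>. The zero extension of \<open>f\<close> then takes over the role of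
  the limits \<open>s \<le> x\<close> and \<open>t \<le> y\<close>, so that the domain of integration no longer depends on the point
  \<open>(x, y)\<close>.
\<close>
lemma mixed_RL_integral_eq_convolution:
  assumes f: "continuous_on unit_square f" and pos: "\<alpha> > 0" "\<beta> > 0" and p: "p \<in> unit_square"
  shows "mixed_RL_integral (\<alpha>, \<beta>) f p =
    (LINT w|lborel. mixed_RL_kernel \<alpha> \<beta> w * zero_extension f (p - w))"
proof -
  obtain x y where xy: "p = (x, y)" "0 \<le> x" "x \<le> 1" "0 \<le> y" "y \<le> 1"
    using p by (auto simp: unit_square_def)
  define G where "G = 1 / (Gamma \<alpha> * Gamma \<beta>)"
  let ?I = "\<lambda>u v. indicator {0..x} u *\<^sub>R (indicator {0..y} v *\<^sub>R
      ((x - u) powr (\<alpha> - 1) * (y - v) powr (\<beta> - 1) * f (u, v)))"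
  have reflect: "(LINT u|lborel. h u) = (LINT s|lborel. h (a - s))" for h :: "real \<Rightarrow> real" and a
    using lborel_integral_real_affine[of "-1" h a] by simp
  have kernel: "?I (x - s) (y - t)
      = RL_kernel \<alpha> s * RL_kernel \<beta> t * zero_extension f (p - (s, t))" for s t
    using xy by (auto simp: RL_kernel_def zero_extension_def unit_square_def indicator_def)
  have "mixed_RL_integral (\<alpha>, \<beta>) f p = G * (LINT u|lborel. LINT v|lborel. ?I u v)"
    by (simp add: mixed_RL_integral_def xy(1) G_def set_lebesgue_integral_def)
  also have "(LINT u|lborel. LINT v|lborel. ?I u v) = (LINT s|lborel. LINT v|lborel. ?I (x - s) v)"
    by (rule reflect)
  also have "\<dots> = (LINT s|lborel. LINT t|lborel. ?I (x - s) (y - t))"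
    by (subst reflect[of _ y]) (rule refl)
  also have "\<dots> = (LINT s|lborel. LINT t|lborel.
      RL_kernel \<alpha> s * RL_kernel \<beta> t * zero_extension f (p - (s, t)))"
    by (simp only: kernel)
  also have "G * \<dots> = (LINT s|lborel. LINT t|lborel.
      mixed_RL_kernel \<alpha> \<beta> (s, t) * zero_extension f (p - (s, t)))"
    by (simp add: mixed_RL_kernel_def G_def mult.assoc)
  also have "\<dots> = (LINT w|lborel. mixed_RL_kernel \<alpha> \<beta> w * zero_extension f (p - w))"
    using lborel_pair.integral_fst'[of "\<lambda>w. mixed_RL_kernel \<alpha> \<beta> w * zero_extension f (p - w)"]
      integrable_kernel_zero_extension[OF f mixed_RL_kernel_integrable[OF pos], of p]
    by (simp add: lborel_prod)
  finally show ?thesis .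
qed

section \<open>Box dimension\<close>

text \<open>
  It suffices to compare covering numbers at the scales \<open>1/n\<close> up to constant factors
  in number and in scale, since neither factor survives in the quotient of logarithms. The lower
  bound 2 holds for the graph of every function, so that only the upper bound has to be carried over
  from \<open>f\<close> to \<open>g\<close>.
\<close>
lemma has_box_dim_Gr_transfer:
  fixes f g :: "real \<times> real \<Rightarrow> real"
  assumes f: "has_box_dim (Gr f) 2" and g: "bounded (Gr g)" and C: "C > 0"
    and le: "\<And>n::nat. n > 0 \<Longrightarrow>
      real (covering_number (2 / real n) (Gr g))
        \<le> C * real (covering_number (1 / real n) (Gr f))"
  shows "has_box_dim (Gr g) 2"
proof -
  define r where "r \<delta> = ln (real (covering_number \<delta> (Gr f))) / (- ln \<delta>)" for \<delta>
  have bf: "bounded (Gr f)" and lim: "(r \<longlongrightarrow> 2) (at_right 0)"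
    using f by (auto simp: has_box_dim_def r_def[abs_def])
  define u where "u \<delta> = ln C / (- ln \<delta>) + r (\<delta>/3) * ((- ln (\<delta>/3)) / (- ln \<delta>))" for \<delta>
  have "filterlim (\<lambda>\<delta>::real. \<delta>/3) (at_right 0) (at_right 0)"
    by real_asymp
  then have "((\<lambda>\<delta>. r (\<delta>/3)) \<longlongrightarrow> 2) (at_right 0)"
    by (rule filterlim_compose[OF lim])
  moreover have "((\<lambda>\<delta>::real. ln C / (- ln \<delta>)) \<longlongrightarrow> 0) (at_right 0)"
    by real_asymp
  moreover have "((\<lambda>\<delta>::real. (- ln (\<delta>/3)) / (- ln \<delta>)) \<longlongrightarrow> 1) (at_right 0)"
    by real_asymp
  ultimately have u: "(u \<longlongrightarrow> 0 + 2 * 1) (at_right 0)"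
    unfolding u_def[abs_def] by (intro tendsto_add tendsto_mult)
  have sandwich: "2 \<le> ln (real (covering_number \<delta> (Gr g))) / (- ln \<delta>) \<and>
      ln (real (covering_number \<delta> (Gr g))) / (- ln \<delta>) \<le> u \<delta>" if \<delta>: "0 < \<delta>" "\<delta> < 1" for \<delta>
  proof -
    \<comment> \<open>\<open>k\<close> nodes per side serve for the lower bound; \<open>n\<close> brings \<open>\<delta>\<close> to the scale of the
      comparison, with \<open>2/n \<le> \<delta>\<close> and \<open>\<delta>/3 \<le> 1/n\<close>.\<close>
    define k where "k = nat \<lceil>1/\<delta>\<rceil>"
    define n where "n = nat \<lceil>2/\<delta>\<rceil>"
    define N where "N = real (covering_number \<delta> (Gr g))"
    have k: "1/\<delta> \<le> k" "real k < 1/\<delta> + 1" and n: "2/\<delta> \<le> n" "real n < 2/\<delta> + 1"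
      using \<delta> unfolding k_def n_def by (simp_all add: of_nat_nat) linarith+
    have "\<delta> * (real k - 1) < 1"
      using k(2) \<delta> by (simp add: field_simps)
    then have "k\<^sup>2 \<le> covering_number \<delta> (Gr g)"
      by (rule covering_number_graph_ge[OF g \<delta>(1)])
    then have "(real k)\<^sup>2 \<le> N"
      unfolding N_def by (metis of_nat_le_iff of_nat_power)
    moreover have "(1/\<delta>)\<^sup>2 \<le> (real k)\<^sup>2"
      using k(1) \<delta> by (intro power_mono) auto
    ultimately have lower: "(1/\<delta>)\<^sup>2 \<le> N"
      by linarith
    have pos: "0 < (1/\<delta>)\<^sup>2"
      using \<delta> by simp
    have "ln ((1/\<delta>)\<^sup>2) \<le> ln N"
      using lower pos less_le_trans[OF pos lower] by (subst ln_le_cancel_iff)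
    moreover have "ln ((1/\<delta>)\<^sup>2) = 2 * (- ln \<delta>)"
      using \<delta> by (simp add: ln_realpow ln_div)
    ultimately have ln_lower: "2 * (- ln \<delta>) \<le> ln N"
      by simp
    have n0: "n > 0"
      using n(1) \<delta> by (metis divide_pos_pos less_le_trans of_nat_0_less_iff zero_less_numeral)
    have "real n \<le> 3 / \<delta>"
      using n(2) \<delta> by (simp add: field_simps)
    then have scales: "2/n \<le> \<delta>" "\<delta>/3 \<le> 1/n"
      using n(1) \<delta> n0 by (simp_all add: field_simps)
    have "N \<le> real (covering_number (2/n) (Gr g))"
      unfolding N_def using covering_number_antimono[OF g _ scales(1)] n0 by simp
    also have "\<dots> \<le> C * real (covering_number (1/n) (Gr f))"
      by (rule le[OF n0])
    also have "\<dots> \<le> C * real (covering_number (\<delta>/3) (Gr f))"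
      using covering_number_antimono[OF bf _ scales(2)] \<delta> C by (intro mult_left_mono) auto
    finally have upper: "N \<le> C * real (covering_number (\<delta>/3) (Gr f))" .
    have N0: "0 < N"
      using lower pos by linarith
    then have N': "0 < real (covering_number (\<delta>/3) (Gr f))"
      using upper C by (metis less_le_trans zero_less_mult_pos)
    have "ln N \<le> ln (C * real (covering_number (\<delta>/3) (Gr f)))"
      using upper N0 by (subst ln_le_cancel_iff) auto
    also have "\<dots> = ln C + ln (real (covering_number (\<delta>/3) (Gr f)))"
      using C N' by (simp add: ln_mult)
    finally have ln_upper: "ln N \<le> ln C + ln (real (covering_number (\<delta>/3) (Gr f)))" .
    have l: "0 < - ln \<delta>" and l3: "0 < - ln (\<delta>/3)"
      using \<delta> by (simp_all add: ln_div)
    have "u \<delta> = (ln C + ln (real (covering_number (\<delta>/3) (Gr f)))) / (- ln \<delta>)"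
      unfolding u_def r_def using l l3 by (simp add: add_divide_distrib)
    then have "ln N / (- ln \<delta>) \<le> u \<delta>"
      using ln_upper l by (simp only: divide_right_mono less_imp_le)
    moreover have "2 \<le> ln N / (- ln \<delta>)"
      using ln_lower l by (simp only: pos_le_divide_eq)
    ultimately show ?thesis
      by (simp add: N_def)
  qed
  have ev: "eventually (\<lambda>\<delta>::real. 0 < \<delta> \<and> \<delta> < 1) (at_right 0)"
    using eventually_at_right_less[of "0::real"] eventually_at_right_real[of 0 "1::real"]
    by (auto elim: eventually_mono)
  have "((\<lambda>\<delta>. ln (real (covering_number \<delta> (Gr g))) / (- ln \<delta>)) \<longlongrightarrow> 2) (at_right 0)"
  proof (rule tendsto_sandwich)
    show "eventually (\<lambda>\<delta>. 2 \<le> ln (real (covering_number \<delta> (Gr g))) / (- ln \<delta>)) (at_right 0)"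
      using ev sandwich by (auto elim: eventually_mono)
    show "eventually (\<lambda>\<delta>. ln (real (covering_number \<delta> (Gr g))) / (- ln \<delta>) \<le> u \<delta>) (at_right 0)"
      using ev sandwich by (auto elim: eventually_mono)
    show "(u \<longlongrightarrow> 2) (at_right 0)"
      using u by simp
  qed simp
  moreover have "Gr g \<noteq> {}"
    by (force simp: Gr_def unit_square_def)
  ultimately show ?thesis
    using g by (simp add: has_box_dim_def)
qed

theorem theorem5p1:
  fixes f :: "real \<times> real \<Rightarrow> real" and \<gamma>\<^sub>1 \<gamma>\<^sub>2 :: real
  assumes "continuous_on unit_square f"
    and "\<And>p. p \<in> unit_square \<Longrightarrow> 0 \<le> f p"
    and "0 < \<gamma>\<^sub>1" and "\<gamma>\<^sub>1 < 1"
    and "0 < \<gamma>\<^sub>2" and "\<gamma>\<^sub>2 < 1"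
    and "has_box_dim (Gr f) 2"
  shows "has_box_dim (Gr (mixed_RL_integral (\<gamma>\<^sub>1, \<gamma>\<^sub>2) f)) 2"
proof -
  let ?K = "mixed_RL_kernel \<gamma>\<^sub>1 \<gamma>\<^sub>2" and ?g = "mixed_RL_integral (\<gamma>\<^sub>1, \<gamma>\<^sub>2) f"
  have "0 \<le> fst w \<and> 0 \<le> snd w" if "?K w \<noteq> 0" for w
    using that by (auto simp: mixed_RL_kernel_def RL_kernel_def indicator_def split: if_splits)
  note convolution = convolution_covering_number_le[OF assms(1)
      mixed_RL_kernel_integrable[OF assms(3,5)] this
      mixed_RL_integral_eq_convolution[OF assms(1,3,5)]]
  obtain C where "C > 0"
    "\<And>n. n > 0 \<Longrightarrow> real (covering_number (2 / real n) (Gr ?g))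
      \<le> C * real (covering_number (1 / real n) (Gr f))"
    using convolution(2) by auto
  then show ?thesis
    using has_box_dim_Gr_transfer[OF assms(7) bounded_Gr[OF convolution(1)]] by blast
qed

end
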